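(* Consider a linear bandit problem with action set $\mathcal{A}=\{1,2\}$, feature dimension $d=1$, context matrix $\mathcal{X}=[1\;\;2]$ (i.e. $x_1=1$, $x_2=2$), mean reward vector $\mu=(\mu_1,\mu_2)^T$ with $\mu_2>\mu_1$ and $\mu_2\neq 2\mu_1$, written as $\mu=\mathcal{X}^T\theta^*+\epsilon$ with deviation vector $\epsilon=(\epsilon_1,\epsilon_2)^T$ such that $|\epsilon_i|>c$ for $i=1,2$, where $c>0$ (and $\mu$ has the $(l,\beta)$ deviation property with $l=c$ and $\beta=0$). There exists a problem instance of this form for which the expected regret of the OFUL algorithm until time $T$ satisfies $\mathbb{E}(R_{OFUL}(T))=\Omega(T)$.
   Context: Bandit problem: $N$ arms, arm $i$ has known feature $x_i\in\mathbb{R}^d$ and expected reward $\mu_i$. At time $t$ the learner plays $A_t\in\{1,\dots,N\}$ and observes $Y_t=\mu_{A_t}+\eta_t$, where $\eta_t$ is zero-mean noise, conditionally $R$-sub-Gaussian given $A_t$. Here $\mu=\mathcal{X}^T\theta^*+\epsilon$, where $\mathcal{X}$ has the features as columns. Regret: $R(T)=T\max_i\mu_i-\sum_{t=1}^T\mu_{A_t}$. $(l,\beta)$ deviation property: given features $x_1,\dots,x_N\in\mathbb{R}^d$ and constants $l>0$, $\beta\in[0,1]$, the vector $\mu\in\mathbb{R}^N$ has the $(l,\beta)$ deviation property if $$\mathbb{P}\big(|x_{i_{d+1}}^T[X_{i_1,\dots,i_d}]^{-1}\mu_{i_1,\dots,i_d}-\mu_{i_{d+1}}|\ge l\big)\ge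 1-\beta$$ for $\{i_1,\dots,i_{d+1}\}\subseteq\{1,\dots,N\}$ with $x_{i_1},\dots,x_{i_d}$ linearly independent, where $X_{i_1,\dots,i_d}$ is the $d\times d$ matrix with rows $x_{i_1}^T,\dots,x_{i_d}^T$, $\mu_{i_1,\dots,i_d}=(\mu_{i_1},\dots,\mu_{i_d})^T$, and the randomness is over the choice of the $d+1$ arms. OFUL (Optimism in the Face of Uncertainty Linear bandit), with regularization parameter $\lambda>0$, confidence parameter $\tilde\delta\in(0,1)$, sub-Gaussian constant $R$ and norm bound $S$: after round $t$, let $\bar V_t=\lambda I+\sum_{s\le t}x_{A_s}x_{A_s}^T$, $\hat\theta_t=\bar V_t^{-1}\sum_{s\le t}x_{A_s}Y_s$, and $$C_t=\Big\{\theta\in\mathbb{R}^d:\ \|\hat\theta_t-\theta\|_{\bar V_t}\le R\sqrt{2\log\big(\det(\bar V_t)^{1/2}\det(\lambda I)^{-1/2}/\tilde\delta\big)}+\lambda^{1/2}S\Big\},$$ where $\|v\|_M=\sqrt{v^TMv}$. At round $t+1$ OFUL plays an arm $i$ maximizing $\max_{\theta\in C_t}x_i^T\theta$. $\Omega(T)$: at least a positive constant times $T$ for all large $T$. *)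

theory Defs
  imports "HOL-Analysis.Analysis" "HOL-Probability.Probability"
begin

text \<open>
  A context matrix \<open>X :: real^'n^'d\<close> has the feature vector of arm \<open>i\<close> as its column
  \<open>column i X :: real^'d\<close>; the index type \<open>'n\<close> is the set of arms.
\<close>

section \<open>The deviation property\<close>

text \<open>
  A choice of \<open>d + 1\<close> arms is a pair \<open>(f, j)\<close>: the arms \<open>f k\<close> determine the linear
  system and \<open>j\<close> is the remaining arm, whose mean is predicted from it.
  All \<open>d + 1\<close> arms are distinct. Injectivity of the features along \<open>f\<close> is needed because
  \<^const>\<open>independent\<close> is a property of sets rather than of families.
\<close>

definition arm_choices :: "real^'n^'d \<Rightarrow> (('d \<Rightarrow> 'n) \<times> 'n) set" where
  "arm_choices X = {(f, j). inj f \<and> j \<notin> range f \<and>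
     inj (\<lambda>k. column (f k) X) \<and> independent (range (\<lambda>k. column (f k) X))}"

definition prediction_error :: "real^'n^'d \<Rightarrow> real^'n \<Rightarrow> ('d \<Rightarrow> 'n) \<Rightarrow> 'n \<Rightarrow> real" where
  "prediction_error X \<mu> f j =
     \<bar>column j X \<bullet> (matrix_inv (\<chi> k. column (f k) X) *v (\<chi> k. \<mu> $ f k)) - \<mu> $ j\<bar>"

text \<open>
  The choice is uniform over all admissible ones. The guard only matters when there is no
  admissible choice, where \<^const>\<open>pmf_of_set\<close> is unspecified; the property is then vacuous.
\<close>

definition deviation_property :: "real^'n^'d \<Rightarrow> real \<Rightarrow> real \<Rightarrow> real^'n \<Rightarrow> bool" where
  "deviation_property X l \<beta> \<mu> \<longleftrightarrow> 0 < l \<and> 0 \<le> \<beta> \<and> \<beta> \<le> 1 \<and>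
     (arm_choices X \<noteq> {} \<longrightarrow>
       measure_pmf.prob (pmf_of_set (arm_choices X)) {(f, j). prediction_error X \<mu> f j \<ge> l}
         \<ge> 1 - \<beta>)"


section \<open>OFUL\<close>

text \<open>
  Below, \<open>a s\<close> and \<open>y s\<close> are the arm played and the reward observed in round \<open>s\<close>.
  Rounds are numbered from 1; the values at 0 are irrelevant.
\<close>

definition outer_square :: "real^'d \<Rightarrow> real^'d^'d" where
  "outer_square v = (\<chi> i j. v $ i * v $ j)"

definition gram :: "real \<Rightarrow> real^'n^'d \<Rightarrow> (nat \<Rightarrow> 'n) \<Rightarrow> nat \<Rightarrow> real^'d^'d" where
  "gram lam X a t = mat lam + (\<Sum>s\<in>{1..t}. outer_square (column (a s) X))"

definition theta_hat ::
  "real \<Rightarrow> real^'n^'d \<Rightarrow> (nat \<Rightarrow> 'n) \<Rightarrow> (nat \<Rightarrow> real) \<Rightarrow> nat \<Rightarrow> real^'d" where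
  "theta_hat lam X a y t =
     matrix_inv (gram lam X a t) *v (\<Sum>s\<in>{1..t}. y s *\<^sub>R column (a s) X)"

definition weighted_norm :: "real^'d^'d \<Rightarrow> real^'d \<Rightarrow> real" where
  "weighted_norm B v = sqrt (v \<bullet> (B *v v))"

definition conf_set ::
  "real \<Rightarrow> real \<Rightarrow> real \<Rightarrow> real \<Rightarrow> real^'n^'d \<Rightarrow> (nat \<Rightarrow> 'n) \<Rightarrow> (nat \<Rightarrow> real) \<Rightarrow> nat
     \<Rightarrow> (real^'d) set" where
  "conf_set R S lam \<delta> X a y t =
     {\<theta>. weighted_norm (gram lam X a t) (theta_hat lam X a y t - \<theta>)
          \<le> R * sqrt (2 * ln (det (gram lam X a t) powr (1/2)
                               * det (mat lam :: real^'d^'d) powr (-1/2) / \<delta>))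
            + lam powr (1/2) * S}"

text \<open>
  For \<open>lam > 0\<close>, \<open>\<delta> < 1\<close>, \<open>R \<ge> 0\<close> and \<open>S \<ge> 0\<close> the confidence set is nonempty and compact, so the
  supremum below is a maximum.
\<close>

definition optimistic_value ::
  "real \<Rightarrow> real \<Rightarrow> real \<Rightarrow> real \<Rightarrow> real^'n^'d \<Rightarrow> (nat \<Rightarrow> 'n) \<Rightarrow> (nat \<Rightarrow> real) \<Rightarrow> nat
     \<Rightarrow> 'n \<Rightarrow> real" where
  "optimistic_value R S lam \<delta> X a y t i =
     (SUP \<theta>\<in>conf_set R S lam \<delta> X a y t. column i X \<bullet> \<theta>)"


section \<open>Runs of OFUL\<close>

definition sigma_gen :: "'a measure \<Rightarrow> ('a \<Rightarrow> 'n) \<Rightarrow> 'a measure" where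
  "sigma_gen M A = vimage_algebra (space M) A (count_space UNIV)"

locale bandit_run = prob_space M for M :: "'a measure" +
  fixes R :: real and \<mu> :: "real^'n" and A :: "nat \<Rightarrow> 'a \<Rightarrow> 'n" and \<eta> :: "nat \<Rightarrow> 'a \<Rightarrow> real"
  assumes arm_measurable: "t \<ge> 1 \<Longrightarrow> A t \<in> M \<rightarrow>\<^sub>M count_space UNIV"
    and noise_integrable: "t \<ge> 1 \<Longrightarrow> integrable M (\<eta> t)"
    and noise_zero_mean:
      "t \<ge> 1 \<Longrightarrow> AE \<omega> in M. real_cond_exp M (sigma_gen M (A t)) (\<eta> t) \<omega> = 0"
    and noise_exp_integrable: "t \<ge> 1 \<Longrightarrow> integrable M (\<lambda>\<omega>. exp (u * \<eta> t \<omega>))"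
    and noise_sub_gaussian:
      "t \<ge> 1 \<Longrightarrow> AE \<omega> in M.
         real_cond_exp M (sigma_gen M (A t)) (\<lambda>\<omega>. exp (u * \<eta> t \<omega>)) \<omega> \<le> exp (u\<^sup>2 * R\<^sup>2 / 2)"
begin

definition reward :: "nat \<Rightarrow> 'a \<Rightarrow> real" where
  "reward t \<omega> = \<mu> $ A t \<omega> + \<eta> t \<omega>"

end

definition regret :: "real^'n \<Rightarrow> (nat \<Rightarrow> 'n) \<Rightarrow> nat \<Rightarrow> real" where
  "regret \<mu> a T = real T * (MAX i. \<mu> $ i) - (\<Sum>t\<in>{1..T}. \<mu> $ a t)"

text \<open>Ties between maximizing arms may be broken in any way.\<close>

locale oful_run = bandit_run M R \<mu> A \<eta>
  for M :: "'a measure" and R :: real and \<mu> :: "real^'n"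
    and A :: "nat \<Rightarrow> 'a \<Rightarrow> 'n" and \<eta> :: "nat \<Rightarrow> 'a \<Rightarrow> real" +
  fixes X :: "real^'n^'d" and lam \<delta> S :: real
  assumes oful_plays:
    "\<omega> \<in> space M \<Longrightarrow>
       is_arg_max (optimistic_value R S lam \<delta> X (\<lambda>s. A s \<omega>) (\<lambda>s. reward s \<omega>) t)
         (\<lambda>_. True) (A (Suc t) \<omega>)"

end

theory Submission
  imports Defs "HOL-Real_Asymp.Real_Asymp"
begin

text \<open>
  Take \<open>\<theta> = 0\<close> and \<open>\<mu> = (-3c, -2c)\<close>. In dimension one the optimistic value of arm \<open>i\<close> is \<open>x\<^sub>i\<close> times
  the upper end of the confidence interval, so OFUL plays the optimal arm 2 only while that upper
  end is nonnegative. Whichever arms are played, the means contribute at most \<open>-2ct\<close> to the sum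
  \<open>\<Sum>s\<le>t. x\<^sub>s Y\<^sub>s\<close>, while the confidence width contributes only \<open>o(t)\<close> on the same scale; hence for
  large \<open>t\<close>, playing arm 2 in round
  \<open>t + 1\<close> forces the weighted noise \<open>N\<^sub>t = \<Sum>s\<le>t. x\<^sub>s \<eta>\<^sub>s\<close> to exceed \<open>c t\<close>.

  As the noise is only controlled conditionally on the current arm, no concentration inequality is
  available for \<open>N\<^sub>t\<close>. But \<open>N\<^sub>t / t\<close> has mean zero and a second moment bounded in \<open>t\<close>, and such a
  variable cannot exceed \<open>c\<close> with probability close to 1. So the suboptimal arm 1 is played
  in every late round with probability bounded away from 0.
\<close>

section \<open>Centered variables with bounded second moment\<close>

text \<open>A one-sided Chebyshev-type bound. Mean zero forces the positive mass of \<open>Z\<close>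
  off \<open>E\<close> to be offset on \<open>E\<close>, and a bounded second moment limits how much
  negative mass a small event can carry.\<close>

lemma (in prob_space) prob_ge_of_centered:
  fixes Z :: "'a \<Rightarrow> real"
  assumes Z: "integrable M Z" and Z2: "integrable M (\<lambda>\<omega>. (Z \<omega>)\<^sup>2)"
    and mean: "expectation Z = 0" and var: "expectation (\<lambda>\<omega>. (Z \<omega>)\<^sup>2) \<le> B"
    and "B > 0" "\<kappa> > 0" and E: "E \<in> events"
    and large: "\<And>\<omega>. \<omega> \<in> space M - E \<Longrightarrow> \<kappa> \<le> Z \<omega>"
  shows "\<kappa>\<^sup>2 / (2 * \<kappa>\<^sup>2 + B) \<le> prob E"
proof -
  \<comment> \<open>With this weight the second-moment penalty \<open>\<alpha> * B\<close> is
    exactly half of \<open>\<kappa>\<close>, so the other half must be paid for by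
    \<open>prob E\<close>.\<close>
  define \<alpha> where "\<alpha> = \<kappa> / (2 * B)"
  have \<alpha>: "\<alpha> > 0" using assms by (simp add: \<alpha>_def)
  have iE: "integrable M (indicator E :: 'a \<Rightarrow> real)"
    using E by (simp add: emeasure_eq_measure)
  \<comment> \<open>The integrand is a pointwise minorant of \<open>Z\<close>: off \<open>E\<close>
    it is at most \<open>\<kappa>\<close>, and on \<open>E\<close> it is the downward parabola
    obtained by completing the square.\<close>
  have "expectation (\<lambda>\<omega>. \<kappa> - (\<kappa> + 1 / (4 * \<alpha>)) * indicator E \<omega> - \<alpha> * (Z \<omega>)\<^sup>2) \<le> expectation Z"
  proof (intro integral_mono)
    fix \<omega> assume \<omega>: "\<omega> \<in> space M"
    show "\<kappa> - (\<kappa> + 1 / (4 * \<alpha>)) * indicator E \<omega> - \<alpha> * (Z \<omega>)\<^sup>2 \<le> Z \<omega>"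
    proof (cases "\<omega> \<in> E")
      case True
      have "0 \<le> \<alpha> * (Z \<omega> + 1 / (2 * \<alpha>))\<^sup>2" using \<alpha> by simp
      also have "\<dots> = \<alpha> * (Z \<omega>)\<^sup>2 + Z \<omega> + 1 / (4 * \<alpha>)"
        using \<alpha> by (simp add: field_simps power2_eq_square)
      finally show ?thesis using True by simp
    next
      case False
      moreover have "0 \<le> \<alpha> * (Z \<omega>)\<^sup>2" using \<alpha> by simp
      ultimately show ?thesis using large[of \<omega>] \<omega> by simp
    qed
  qed (use Z Z2 iE in auto)
  also have "expectation (\<lambda>\<omega>. \<kappa> - (\<kappa> + 1 / (4 * \<alpha>)) * indicator E \<omega> - \<alpha> * (Z \<omega>)\<^sup>2)
      = \<kappa> - (\<kappa> + 1 / (4 * \<alpha>)) * prob E - \<alpha> * expectation (\<lambda>\<omega>. (Z \<omega>)\<^sup>2)"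
    using Z2 iE E by (simp add: prob_space)
  finally have "\<kappa> \<le> (\<kappa> + 1 / (4 * \<alpha>)) * prob E + \<alpha> * expectation (\<lambda>\<omega>. (Z \<omega>)\<^sup>2)"
    using mean by simp
  also have "\<dots> \<le> (\<kappa> + 1 / (4 * \<alpha>)) * prob E + \<alpha> * B"
    using var \<alpha> by (simp add: mult_left_mono)
  also have "\<alpha> * B = \<kappa> / 2" using \<open>B > 0\<close> by (simp add: \<alpha>_def)
  also have "1 / (4 * \<alpha>) = B / (2 * \<kappa>)" using \<open>B > 0\<close> \<open>\<kappa> > 0\<close> by (simp add: \<alpha>_def field_simps)
  finally have "\<kappa> / 2 \<le> (\<kappa> + B / (2 * \<kappa>)) * prob E" by simp
  then have "2 * \<kappa> * (\<kappa> / 2) \<le> 2 * \<kappa> * ((\<kappa> + B / (2 * \<kappa>)) * prob E)"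
    using \<open>\<kappa> > 0\<close> by (intro mult_left_mono) auto
  moreover have "2 * \<kappa> * (\<kappa> + B / (2 * \<kappa>)) = 2 * \<kappa>\<^sup>2 + B"
    using \<open>\<kappa> > 0\<close> by (simp add: distrib_left power2_eq_square)
  ultimately have "\<kappa>\<^sup>2 \<le> (2 * \<kappa>\<^sup>2 + B) * prob E"
    by (simp add: power2_eq_square mult.assoc[symmetric])
  moreover have "2 * \<kappa>\<^sup>2 + B > 0" using \<open>B > 0\<close> by (simp add: add_nonneg_pos)
  ultimately show ?thesis by (simp add: field_simps)
qed

section \<open>Weighted noise\<close>

context bandit_run
begin

section \<open>Measurability and boundedness of functions of the arm played\<close>

lemma sigma_gen_subalgebra:
  assumes "t \<ge> 1"
  shows "finite_measure_subalgebra M (sigma_gen M (A t))"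
proof unfold_locales
  show "subalgebra M (sigma_gen M (A t))"
    unfolding subalgebra_def sigma_gen_def
    using sets_image_in_sets[OF refl arm_measurable[OF assms]] by simp
qed

lemma arm_function_measurable:
  fixes f :: "'n \<Rightarrow> real"
  assumes "t \<ge> 1"
  shows "(\<lambda>\<omega>. f (A t \<omega>)) \<in> borel_measurable (sigma_gen M (A t))"
    and "(\<lambda>\<omega>. f (A t \<omega>)) \<in> borel_measurable M"
proof -
  have "A t \<in> sigma_gen M (A t) \<rightarrow>\<^sub>M count_space UNIV"
    unfolding sigma_gen_def by (rule measurable_vimage_algebra1) simp
  then show "(\<lambda>\<omega>. f (A t \<omega>)) \<in> borel_measurable (sigma_gen M (A t))"
    by (rule measurable_compose) simp
  show "(\<lambda>\<omega>. f (A t \<omega>)) \<in> borel_measurable M"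
    by (rule measurable_compose[OF arm_measurable[OF assms]]) simp
qed

lemma arm_event:
  assumes "t \<ge> 1"
  shows "{\<omega> \<in> space M. A t \<omega> = i} \<in> events"
  using measurable_sets[OF arm_measurable[OF assms], of "{i}"]
  by (simp add: vimage_def Int_def conj_commute)

lemma arm_function_bounded:
  fixes f :: "'n \<Rightarrow> real"
  shows "\<bar>f i\<bar> \<le> Max (range (\<lambda>j. \<bar>f j\<bar>))"
  by (intro Max_ge) auto

lemma integrable_arm_function:
  fixes f :: "'n \<Rightarrow> real"
  assumes "t \<ge> 1"
  shows "integrable M (\<lambda>\<omega>. f (A t \<omega>))"
  using arm_function_measurable(2)[OF assms] arm_function_bounded[of f]
  by (intro integrable_const_bound[where B = "Max (range (\<lambda>j. \<bar>f j\<bar>))"]) auto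

section \<open>Moments of the noise, alone and weighted by a function of the arm\<close>

lemma integrable_weighted_noise:
  fixes f :: "'n \<Rightarrow> real"
  assumes "t \<ge> 1"
  shows "integrable M (\<lambda>\<omega>. f (A t \<omega>) * \<eta> t \<omega>)"
proof (rule Bochner_Integration.integrable_bound)
  show "integrable M (\<lambda>\<omega>. Max (range (\<lambda>j. \<bar>f j\<bar>)) * \<eta> t \<omega>)"
    using noise_integrable[OF assms] by simp
  show "(\<lambda>\<omega>. f (A t \<omega>) * \<eta> t \<omega>) \<in> borel_measurable M"
    using arm_function_measurable(2)[OF assms, of f] noise_integrable[OF assms] by measurable
  show "AE \<omega> in M. norm (f (A t \<omega>) * \<eta> t \<omega>) \<le> norm (Max (range (\<lambda>j. \<bar>f j\<bar>)) * \<eta> t \<omega>)"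
    using order_trans[OF arm_function_bounded[of f] abs_ge_self]
    by (intro AE_I2) (simp add: abs_mult mult_right_mono)
qed

text \<open>The weight is measurable with respect to the arm of the same round, so it can be pulled
  out of the conditional expectation of the noise, which vanishes.\<close>

lemma expectation_weighted_noise:
  fixes f :: "'n \<Rightarrow> real"
  assumes "t \<ge> 1"
  shows "expectation (\<lambda>\<omega>. f (A t \<omega>) * \<eta> t \<omega>) = 0"
proof -
  interpret F: finite_measure_subalgebra M "sigma_gen M (A t)"
    by (rule sigma_gen_subalgebra[OF assms])
  have \<eta>[measurable]: "\<eta> t \<in> borel_measurable M" using noise_integrable[OF assms] by simp
  have "expectation (\<lambda>\<omega>. f (A t \<omega>) * \<eta> t \<omega>)
      = expectation (\<lambda>\<omega>. f (A t \<omega>) * real_cond_exp M (sigma_gen M (A t)) (\<eta> t) \<omega>)"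
    using F.real_cond_exp_intg(2)[OF integrable_weighted_noise[OF assms, of f]
        arm_function_measurable(1)[OF assms] \<eta>] by simp
  also have "\<dots> = 0"
    using noise_zero_mean[OF assms] by (intro integral_eq_zero_AE) auto
  finally show ?thesis .
qed

lemma expectation_exp_noise_le:
  assumes "t \<ge> 1"
  shows "expectation (\<lambda>\<omega>. exp (u * \<eta> t \<omega>)) \<le> exp (u\<^sup>2 * R\<^sup>2 / 2)"
proof -
  interpret F: finite_measure_subalgebra M "sigma_gen M (A t)"
    by (rule sigma_gen_subalgebra[OF assms])
  note int = noise_exp_integrable[OF assms, of u]
  have "expectation (\<lambda>\<omega>. exp (u * \<eta> t \<omega>))
      = expectation (real_cond_exp M (sigma_gen M (A t)) (\<lambda>\<omega>. exp (u * \<eta> t \<omega>)))"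
    by (simp add: F.real_cond_exp_int(2)[OF int])
  also have "\<dots> \<le> expectation (\<lambda>_. exp (u\<^sup>2 * R\<^sup>2 / 2))"
    using F.real_cond_exp_int(1)[OF int] noise_sub_gaussian[OF assms, of u]
    by (intro integral_mono_AE) auto
  finally show ?thesis by (simp add: prob_space)
qed

text \<open>The square is dominated by exponentials, so the sub-Gaussian bound at
  \<open>u = 1\<close> and \<open>u = -1\<close> is enough. The constant is crude, but it is the
  same for all rounds.\<close>

lemma noise_second_moment:
  assumes "t \<ge> 1"
  shows "integrable M (\<lambda>\<omega>. (\<eta> t \<omega>)\<^sup>2)"
    and "expectation (\<lambda>\<omega>. (\<eta> t \<omega>)\<^sup>2) \<le> 4 * exp (R\<^sup>2 / 2)"
proof -
  have sq_le: "x\<^sup>2 \<le> 2 * (exp x + exp (-x))" for x :: real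
  proof -
    have *: "y\<^sup>2 / 2 \<le> exp y" if "y \<ge> 0" for y :: real
      using exp_lower_Taylor_quadratic[OF that] that by linarith
    show ?thesis
    proof (cases "x \<ge> 0")
      case True
      then show ?thesis using *[of x] exp_ge_zero[of "-x"] unfolding distrib_left by linarith
    next
      case False
      then have "x\<^sup>2 / 2 \<le> exp (-x)" using *[of "-x"] by simp
      then show ?thesis using exp_ge_zero[of x] unfolding distrib_left by linarith
    qed
  qed
  have int: "integrable M (\<lambda>\<omega>. 2 * (exp (\<eta> t \<omega>) + exp (- \<eta> t \<omega>)))"
    using noise_exp_integrable[OF assms, of 1] noise_exp_integrable[OF assms, of "-1"] by simp
  show int2: "integrable M (\<lambda>\<omega>. (\<eta> t \<omega>)\<^sup>2)"
    using noise_integrable[OF assms] sq_le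
    by (intro Bochner_Integration.integrable_bound[OF int]) auto
  have "expectation (\<lambda>\<omega>. (\<eta> t \<omega>)\<^sup>2) \<le> expectation (\<lambda>\<omega>. 2 * (exp (\<eta> t \<omega>) + exp (- \<eta> t \<omega>)))"
    by (intro integral_mono int int2 sq_le)
  also have "\<dots> = 2 * (expectation (\<lambda>\<omega>. exp (\<eta> t \<omega>)) + expectation (\<lambda>\<omega>. exp (- \<eta> t \<omega>)))"
    using noise_exp_integrable[OF assms, of 1] noise_exp_integrable[OF assms, of "-1"] by simp
  also have "\<dots> \<le> 4 * exp (R\<^sup>2 / 2)"
    using expectation_exp_noise_le[OF assms, of 1] expectation_exp_noise_le[OF assms, of "-1"]
    by simp
  finally show "expectation (\<lambda>\<omega>. (\<eta> t \<omega>)\<^sup>2) \<le> 4 * exp (R\<^sup>2 / 2)" .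
qed

text \<open>Noises of different rounds may be correlated, so cross terms need not cancel.
  Cauchy-Schwarz still bounds the squared sum by \<open>t\<close> times the sum of squares, which
  the division by \<open>t\<close> squared offsets: the second moment need not decay, but stays
  bounded.\<close>

lemma average_weighted_noise:
  fixes f :: "'n \<Rightarrow> real"
  assumes f: "\<And>i. \<bar>f i\<bar> \<le> L" and t: "t \<ge> 1"
  defines "Z \<equiv> \<lambda>\<omega>. (\<Sum>s\<in>{1..t}. f (A s \<omega>) * \<eta> s \<omega>) / real t"
  shows "integrable M Z" "expectation Z = 0" "integrable M (\<lambda>\<omega>. (Z \<omega>)\<^sup>2)"
    "expectation (\<lambda>\<omega>. (Z \<omega>)\<^sup>2) \<le> L\<^sup>2 * (4 * exp (R\<^sup>2 / 2))"
proof -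
  show Z: "integrable M Z"
    unfolding Z_def by (intro integrable_divide Bochner_Integration.integrable_sum integrable_weighted_noise) auto
  have "expectation (\<lambda>\<omega>. \<Sum>s\<in>{1..t}. f (A s \<omega>) * \<eta> s \<omega>)
      = (\<Sum>s\<in>{1..t}. expectation (\<lambda>\<omega>. f (A s \<omega>) * \<eta> s \<omega>))"
    by (intro Bochner_Integration.integral_sum integrable_weighted_noise) auto
  then show "expectation Z = 0" by (simp add: Z_def expectation_weighted_noise)
  have bound: "(Z \<omega>)\<^sup>2 \<le> (\<Sum>s\<in>{1..t}. L\<^sup>2 * (\<eta> s \<omega>)\<^sup>2) / real t" for \<omega>
  proof -
    have "(\<Sum>s\<in>{1..t}. f (A s \<omega>) * \<eta> s \<omega>)\<^sup>2 \<le> (\<Sum>s\<in>{1..t}. (f (A s \<omega>) * \<eta> s \<omega>)\<^sup>2) * real t"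
      using sum_squared_le_sum_of_squares[of "\<lambda>s. f (A s \<omega>) * \<eta> s \<omega>" "{1..t}"] by simp
    also have "\<dots> \<le> (\<Sum>s\<in>{1..t}. L\<^sup>2 * (\<eta> s \<omega>)\<^sup>2) * real t"
      using f unfolding power_mult_distrib
      by (intro mult_right_mono sum_mono abs_le_square_iff[THEN iffD1])
        (auto intro: order_trans[OF f abs_ge_self])
    finally show ?thesis using t by (simp add: Z_def power_divide field_simps power2_eq_square)
  qed
  have int: "integrable M (\<lambda>\<omega>. (\<Sum>s\<in>{1..t}. L\<^sup>2 * (\<eta> s \<omega>)\<^sup>2) / real t)"
    by (intro integrable_divide Bochner_Integration.integrable_sum integrable_mult_right
        noise_second_moment) auto
  show Z2: "integrable M (\<lambda>\<omega>. (Z \<omega>)\<^sup>2)"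
  proof (rule Bochner_Integration.integrable_bound[OF int])
    show "(\<lambda>\<omega>. (Z \<omega>)\<^sup>2) \<in> borel_measurable M" using Z by measurable
    show "AE \<omega> in M. norm ((Z \<omega>)\<^sup>2) \<le> norm ((\<Sum>s\<in>{1..t}. L\<^sup>2 * (\<eta> s \<omega>)\<^sup>2) / real t)"
      using order_trans[OF bound abs_ge_self] by (intro AE_I2) simp
  qed
  have "expectation (\<lambda>\<omega>. (Z \<omega>)\<^sup>2) \<le> expectation (\<lambda>\<omega>. (\<Sum>s\<in>{1..t}. L\<^sup>2 * (\<eta> s \<omega>)\<^sup>2) / real t)"
    by (intro integral_mono Z2 int bound)
  also have "\<dots> = (\<Sum>s\<in>{1..t}. L\<^sup>2 * expectation (\<lambda>\<omega>. (\<eta> s \<omega>)\<^sup>2)) / real t"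
    using noise_second_moment(1) by (simp add: Bochner_Integration.integral_sum)
  also have "\<dots> \<le> (\<Sum>s\<in>{1..t}. L\<^sup>2 * (4 * exp (R\<^sup>2 / 2))) / real t"
    by (intro divide_right_mono sum_mono mult_left_mono noise_second_moment) auto
  also have "\<dots> = L\<^sup>2 * (4 * exp (R\<^sup>2 / 2))" using t by simp
  finally show "expectation (\<lambda>\<omega>. (Z \<omega>)\<^sup>2) \<le> L\<^sup>2 * (4 * exp (R\<^sup>2 / 2))" .
qed

end

section \<open>OFUL in dimension one\<close>

lemma matrix_inv_1:
  fixes B :: "real^1^1"
  assumes "B $ 1 $ 1 \<noteq> 0"
  shows "matrix_inv B $ 1 $ 1 = 1 / B $ 1 $ 1"
proof -
  \<comment> \<open>\<open>matrix_inv\<close> is a choice among two-sided inverses, so one has to be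
    exhibited before anything is known about it.\<close>
  have "\<exists>C. B ** C = mat 1 \<and> C ** B = mat 1"
    using assms
    by (intro exI[of _ "\<chi> i j. 1 / B $ 1 $ 1"]) (simp add: matrix_matrix_mult_def mat_def vec_eq_iff)
  then have "B ** matrix_inv B = mat 1"
    unfolding matrix_inv_def by (rule someI2_ex) simp
  then have "(B ** matrix_inv B) $ 1 $ 1 = 1" by (simp add: mat_def)
  then show ?thesis using assms by (simp add: matrix_matrix_mult_def field_simps)
qed

text \<open>The bound defining \<open>conf_set\<close>, with the determinants replaced by the single
  entries \<open>V\<close> and \<open>lam\<close> that they equal for 1-by-1 matrices.\<close>

definition conf_radius :: "real \<Rightarrow> real \<Rightarrow> real \<Rightarrow> real \<Rightarrow> real \<Rightarrow> real" where
  "conf_radius R S lam \<delta> V =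
     R * sqrt (2 * ln (V powr (1/2) * lam powr (-1/2) / \<delta>)) + lam powr (1/2) * S"

lemma conf_radius_mono:
  assumes "R \<ge> 0" "lam > 0" "\<delta> > 0" "0 < V" "V \<le> W"
  shows "conf_radius R S lam \<delta> V \<le> conf_radius R S lam \<delta> W"
proof -
  have "V powr (1/2) * lam powr (-1/2) / \<delta> \<le> W powr (1/2) * lam powr (-1/2) / \<delta>"
    using assms by (intro divide_right_mono mult_right_mono powr_mono2) auto
  moreover have "0 < V powr (1/2) * lam powr (-1/2) / \<delta>" using assms by simp
  ultimately show ?thesis
    unfolding conf_radius_def using \<open>R \<ge> 0\<close>
    by (intro add_right_mono mult_left_mono real_sqrt_le_mono ln_mono) auto
qed

text \<open>At \<open>V = lam\<close> the logarithm reduces to that of \<open>1 / \<delta>\<close>,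
  which is positive; monotonicity covers larger \<open>V\<close>.\<close>

lemma conf_radius_nonneg:
  assumes "R \<ge> 0" "S \<ge> 0" "lam > 0" "0 < \<delta>" "\<delta> < 1" "lam \<le> V"
  shows "0 \<le> conf_radius R S lam \<delta> V"
proof -
  have "0 \<le> conf_radius R S lam \<delta> lam"
    using assms by (auto simp: conf_radius_def ln_div powr_add[symmetric])
  also have "\<dots> \<le> conf_radius R S lam \<delta> V" using assms by (intro conf_radius_mono) auto
  finally show ?thesis .
qed

text \<open>The radius grows like the square root of a logarithm, so the product is of order
  \<open>sqrt (t * ln t)\<close> at most. The argument \<open>lam + 4 * real t\<close> is the
  largest Gram entry that features 1 and 2 can produce in \<open>t\<close> rounds.\<close>

lemma conf_radius_sublinear:
  assumes "lam > 0" "\<delta> > 0" "c > 0"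
  shows "\<forall>\<^sub>F t in sequentially.
    conf_radius R S lam \<delta> (lam + 4 * real t) * sqrt (lam + 4 * real t) < c * real t"
proof -
  \<comment> \<open>\<open>R\<close> and \<open>S\<close> have no fixed sign here; they are kept out
    of both limits and reinstated afterwards as constant factors.\<close>
  have "(\<lambda>t. sqrt (2 * ln ((lam + 4 * real t) powr (1/2) * lam powr (-1/2) / \<delta>)) *
      sqrt (lam + 4 * real t) / real t) \<longlonglongrightarrow> 0"
    using assms by real_asymp
  moreover have "(\<lambda>t. sqrt (lam + 4 * real t) / real t) \<longlonglongrightarrow> 0"
    using assms by real_asymp
  ultimately have "(\<lambda>t. R * (sqrt (2 * ln ((lam + 4 * real t) powr (1/2) * lam powr (-1/2) / \<delta>)) *
      sqrt (lam + 4 * real t) / real t) + lam powr (1/2) * S * (sqrt (lam + 4 * real t) / real t))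
      \<longlonglongrightarrow> R * 0 + lam powr (1/2) * S * 0"
    by (intro tendsto_intros)
  then have "(\<lambda>t. conf_radius R S lam \<delta> (lam + 4 * real t) * sqrt (lam + 4 * real t) / real t)
      \<longlonglongrightarrow> 0"
    by (simp add: conf_radius_def algebra_simps add_divide_distrib)
  from order_tendstoD(2)[OF this \<open>c > 0\<close>] eventually_gt_at_top[of 0]
  show ?thesis by eventually_elim (simp add: field_simps)
qed

section \<open>The one-dimensional confidence interval and prediction error\<close>

lemma gram_1:
  fixes X :: "real^'n^1"
  shows "gram lam X a t $ 1 $ 1 = lam + (\<Sum>s\<in>{1..t}. (X $ 1 $ a s)\<^sup>2)"
  by (simp add: gram_def outer_square_def column_def mat_def power2_eq_square)

text \<open>The weighted norm is \<open>sqrt V\<close> times the absolute value, so the confidence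
  set is an interval around the estimate, and a nonnegative feature is maximized at its upper end.
  That end is common to all arms.\<close>

lemma optimistic_value_1:
  fixes X :: "real^'n^1" and a :: "nat \<Rightarrow> 'n" and t :: nat
  assumes "R \<ge> 0" "S \<ge> 0" "lam > 0" "0 < \<delta>" "\<delta> < 1" "X $ 1 $ i \<ge> 0"
  defines "V \<equiv> lam + (\<Sum>s\<in>{1..t}. (X $ 1 $ a s)\<^sup>2)"
  shows "optimistic_value R S lam \<delta> X a y t i =
    X $ 1 $ i * ((\<Sum>s\<in>{1..t}. y s * X $ 1 $ a s) / V + conf_radius R S lam \<delta> V / sqrt V)"
proof -
  have "lam \<le> V" by (auto simp: V_def intro: sum_nonneg)
  then have V: "V > 0" using \<open>lam > 0\<close> by simp
  have G: "gram lam X a t $ 1 $ 1 = V" by (simp add: gram_1 V_def)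
  define h w where "h = (\<Sum>s\<in>{1..t}. y s * X $ 1 $ a s) / V"
    and "w = conf_radius R S lam \<delta> V / sqrt V"
  \<comment> \<open>This makes the interval nonempty, so that its upper end is attained and the
    supremum is a maximum.\<close>
  have w: "w \<ge> 0"
    using conf_radius_nonneg[of R S lam \<delta> V] assms \<open>lam \<le> V\<close> V by (simp add: w_def)
  have h: "theta_hat lam X a y t $ 1 = h"
    using V by (simp add: theta_hat_def matrix_vector_mult_def matrix_inv_1 G h_def column_def)
  have conf: "conf_set R S lam \<delta> X a y t = {\<theta>. \<bar>h - \<theta> $ 1\<bar> \<le> w}"
  proof -
    have "weighted_norm (gram lam X a t) v = sqrt V * \<bar>v $ 1\<bar>" for v
    proof -
      have "v \<bullet> (gram lam X a t *v v) = V * (v $ 1)\<^sup>2"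
        by (simp add: inner_vec_def matrix_vector_mult_def G power2_eq_square)
      then show ?thesis by (simp add: weighted_norm_def real_sqrt_mult)
    qed
    moreover have "det (gram lam X a t) = V" "det (mat lam :: real^1^1) = lam"
      by (simp_all add: det_1 G mat_def)
    ultimately show ?thesis
      using V by (simp add: conf_set_def conf_radius_def w_def h pos_le_divide_eq mult.commute)
  qed
  show ?thesis
    unfolding optimistic_value_def conf h_def[symmetric] w_def[symmetric]
  proof (rule cSup_eq_maximum)
    have "(vec (h + w) :: real^1) \<in> {\<theta>. \<bar>h - \<theta> $ 1\<bar> \<le> w}" using w by simp
    moreover have "column i X \<bullet> (vec (h + w) :: real^1) = X $ 1 $ i * (h + w)"
      by (simp add: inner_vec_def column_def)
    ultimately show "X $ 1 $ i * (h + w) \<in> (\<lambda>\<theta>. column i X \<bullet> \<theta>) ` {\<theta>. \<bar>h - \<theta> $ 1\<bar> \<le> w}"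
      by (metis imageI)
  next
    fix z assume "z \<in> (\<lambda>\<theta>. column i X \<bullet> \<theta>) ` {\<theta>. \<bar>h - \<theta> $ 1\<bar> \<le> w}"
    then obtain \<theta> :: "real^1" where "\<bar>h - \<theta> $ 1\<bar> \<le> w" "z = X $ 1 $ i * \<theta> $ 1"
      by (auto simp: inner_vec_def column_def)
    then show "z \<le> X $ 1 $ i * (h + w)"
      using \<open>X $ 1 $ i \<ge> 0\<close> by (auto intro!: mult_left_mono)
  qed
qed

lemma prediction_error_1:
  fixes X :: "real^'n^1"
  assumes "X $ 1 $ f 1 \<noteq> 0"
  shows "prediction_error X \<mu> f j = \<bar>X $ 1 $ j * \<mu> $ f 1 / X $ 1 $ f 1 - \<mu> $ j\<bar>"
  using assms
  by (simp add: prediction_error_def inner_vec_def column_def matrix_vector_mult_def matrix_inv_1)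

section \<open>OFUL on two arms with features 1 and 2\<close>

text \<open>Only two choices arise: predicting arm 2 from arm 1 errs by the quantity in
  \<open>dev\<close>, predicting arm 1 from arm 2 by half of it, hence the factor 2 in front of
  \<open>c\<close>. With both errors large enough, the probability is 1.\<close>

lemma deviation_property_1_2:
  fixes X :: "real^2^1" and \<mu> :: "real^2"
  assumes X: "X $ 1 $ 1 = 1" "X $ 1 $ 2 = 2" and "c > 0" and dev: "2 * c \<le> \<bar>2 * \<mu> $ 1 - \<mu> $ 2\<bar>"
  shows "deviation_property X c 0 \<mu>"
proof -
  let ?D = "{(f, j). c \<le> prediction_error X \<mu> f j}"
  have "arm_choices X \<subseteq> ?D"
  proof clarify
    fix f :: "1 \<Rightarrow> 2" and j assume "(f, j) \<in> arm_choices X"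
    then have "j \<noteq> f 1" by (auto simp: arm_choices_def)
    then consider "f 1 = 1" "j = 2" | "f 1 = 2" "j = 1" using exhaust_2 by metis
    then show "c \<le> prediction_error X \<mu> f j"
      using dev \<open>c > 0\<close> by cases (simp_all add: prediction_error_1 X)
  qed
  then have "measure_pmf.prob (pmf_of_set (arm_choices X)) ?D = 1" if "arm_choices X \<noteq> {}"
    using that by (subst measure_pmf.prob_eq_1) (auto simp: AE_measure_pmf_iff)
  then show ?thesis using \<open>c > 0\<close> by (simp add: deviation_property_def)
qed

text \<open>A pathwise argument: the means leave a deficit of at least
  \<open>2 * c * real t\<close>, the confidence width covers at most half of it, and the noise has
  to supply the rest.\<close>

lemma weighted_noise_large:
  fixes M :: "'a measure" and X :: "real^2^1" and \<mu> :: "real^2"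
  assumes "oful_run M R \<mu> A \<eta> X lam \<delta> S"
    and X: "X $ 1 $ 1 = 1" "X $ 1 $ 2 = 2"
    and \<mu>: "\<And>i. X $ 1 $ i * \<mu> $ i \<le> - 2 * c"
    and "R \<ge> 0" "S \<ge> 0" "lam > 0" "0 < \<delta>" "\<delta> < 1"
    and small: "conf_radius R S lam \<delta> (lam + 4 * real t) * sqrt (lam + 4 * real t) < c * real t"
    and \<omega>: "\<omega> \<in> space M" "A (Suc t) \<omega> \<noteq> 1"
  shows "c * real t \<le> (\<Sum>s\<in>{1..t}. X $ 1 $ A s \<omega> * \<eta> s \<omega>)"
proof -
  interpret oful_run M R \<mu> A \<eta> X lam \<delta> S by fact
  have A2: "A (Suc t) \<omega> = 2" using \<omega>(2) exhaust_2 by metis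
  define V where "V = lam + (\<Sum>s\<in>{1..t}. (X $ 1 $ A s \<omega>)\<^sup>2)"
  define u where "u = (\<Sum>s\<in>{1..t}. reward s \<omega> * X $ 1 $ A s \<omega>) / V + conf_radius R S lam \<delta> V / sqrt V"
  have X_sq: "(X $ 1 $ i)\<^sup>2 \<le> 4" for i using exhaust_2[of i] X by auto
  have "lam \<le> V" by (auto simp: V_def intro: sum_nonneg)
  then have V: "V > 0" using \<open>lam > 0\<close> by simp
  have V_le: "V \<le> lam + 4 * real t"
    using sum_mono[of "{1..t}" "\<lambda>s. (X $ 1 $ A s \<omega>)\<^sup>2" "\<lambda>_. 4"] X_sq by (simp add: V_def)
  have "\<not> optimistic_value R S lam \<delta> X (\<lambda>s. A s \<omega>) (\<lambda>s. reward s \<omega>) t 2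
      < optimistic_value R S lam \<delta> X (\<lambda>s. A s \<omega>) (\<lambda>s. reward s \<omega>) t 1"
    using oful_plays[OF \<omega>(1), of t] by (simp add: is_arg_max_def A2)
  \<comment> \<open>The two optimistic values are \<open>u\<close> and \<open>2 * u\<close> for the
    same upper end \<open>u\<close>, so arm 2 is chosen only if \<open>u\<close> is nonnegative; a
    tie at \<open>u = 0\<close> is included.\<close>
  then have "\<not> 2 * u < 1 * u"
    using assms X by (simp add: optimistic_value_1 u_def V_def)
  \<comment> \<open>Multiplying by \<open>V\<close> frees the reward sum of its denominator.
    \<open>V\<close> then survives only in the width term, which is increasing in \<open>V\<close>
    and so is controlled by \<open>V_le\<close>.\<close>
  then have "0 \<le> u * V" using V by simp
  also have "u * V = (\<Sum>s\<in>{1..t}. reward s \<omega> * X $ 1 $ A s \<omega>) + conf_radius R S lam \<delta> V * sqrt V"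
    using V by (simp add: u_def field_simps)
  also have "conf_radius R S lam \<delta> V * sqrt V
      \<le> conf_radius R S lam \<delta> (lam + 4 * real t) * sqrt (lam + 4 * real t)"
    using assms V V_le \<open>lam \<le> V\<close> by (intro mult_mono conf_radius_mono conf_radius_nonneg) auto
  also have "\<dots> \<le> c * real t" using small by simp
  also have "(\<Sum>s\<in>{1..t}. reward s \<omega> * X $ 1 $ A s \<omega>)
      = (\<Sum>s\<in>{1..t}. X $ 1 $ A s \<omega> * \<mu> $ A s \<omega>) + (\<Sum>s\<in>{1..t}. X $ 1 $ A s \<omega> * \<eta> s \<omega>)"
    by (simp add: reward_def algebra_simps sum.distrib)
  also have "(\<Sum>s\<in>{1..t}. X $ 1 $ A s \<omega> * \<mu> $ A s \<omega>) \<le> real t * (- 2 * c)"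
    using sum_bounded_above[of "{1..t}" "\<lambda>s. X $ 1 $ A s \<omega> * \<mu> $ A s \<omega>" "- 2 * c"] \<mu> by simp
  finally show ?thesis by (simp add: algebra_simps)
qed

text \<open>The usual regret decomposition, gap times expected number of suboptimal plays: the mean
  of the arm played is affine in the indicator of arm 1.\<close>

lemma expected_regret_two_arms:
  fixes \<mu> :: "real^2"
  assumes "bandit_run M R A \<eta>" and "\<mu> $ 1 \<le> \<mu> $ 2"
  shows "(\<integral>\<omega>. regret \<mu> (\<lambda>t. A t \<omega>) T \<partial>M)
    = (\<mu> $ 2 - \<mu> $ 1) * (\<Sum>t\<in>{1..T}. measure M {\<omega> \<in> space M. A t \<omega> = 1})"
proof -
  interpret bandit_run M R \<mu> A \<eta> by fact
  have max: "(MAX i. \<mu> $ i) = \<mu> $ 2"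
    using assms(2) by (simp add: UNIV_2 max_def)
  have mean: "expectation (\<lambda>\<omega>. \<mu> $ A t \<omega>)
      = \<mu> $ 2 - (\<mu> $ 2 - \<mu> $ 1) * prob {\<omega> \<in> space M. A t \<omega> = 1}" if "t \<ge> 1" for t
  proof -
    have "expectation (\<lambda>\<omega>. \<mu> $ A t \<omega>) = expectation
        (\<lambda>\<omega>. \<mu> $ 2 - (\<mu> $ 2 - \<mu> $ 1) * indicator {\<omega> \<in> space M. A t \<omega> = 1} \<omega>)"
    proof (rule Bochner_Integration.integral_cong)
      fix \<omega> assume "\<omega> \<in> space M"
      then show "\<mu> $ A t \<omega> = \<mu> $ 2 - (\<mu> $ 2 - \<mu> $ 1) * indicator {\<omega> \<in> space M. A t \<omega> = 1} \<omega>"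
        using exhaust_2[of "A t \<omega>"] by auto
    qed simp
    also have "\<dots> = \<mu> $ 2 - (\<mu> $ 2 - \<mu> $ 1) * prob {\<omega> \<in> space M. A t \<omega> = 1}"
      using arm_event[OF that] by (simp add: prob_space emeasure_eq_measure)
    finally show ?thesis .
  qed
  have "expectation (\<lambda>\<omega>. regret \<mu> (\<lambda>t. A t \<omega>) T)
      = real T * \<mu> $ 2 - (\<Sum>t\<in>{1..T}. expectation (\<lambda>\<omega>. \<mu> $ A t \<omega>))"
    unfolding regret_def max using integrable_arm_function[of _ "($) \<mu>"]
    by (subst Bochner_Integration.integral_diff)
      (auto simp: prob_space Bochner_Integration.integral_sum
        intro!: Bochner_Integration.integrable_sum)
  also have "\<dots> = (\<mu> $ 2 - \<mu> $ 1) * (\<Sum>t\<in>{1..T}. prob {\<omega> \<in> space M. A t \<omega> = 1})"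
    by (simp add: mean sum_subtractf sum_distrib_left)
  finally show ?thesis .
qed

text \<open>In every late round arm 1 has probability at least \<open>q\<close>, which depends on
  \<open>c\<close> and \<open>R\<close> but not on the round; only the threshold \<open>n\<close>
  involves the other parameters of OFUL. Summing over rounds gives linear growth.\<close>

lemma oful_linear_regret:
  fixes M :: "'a measure" and X :: "real^2^1" and \<mu> :: "real^2"
  assumes run: "oful_run M R \<mu> A \<eta> X lam \<delta> S"
    and X: "X $ 1 $ 1 = 1" "X $ 1 $ 2 = 2"
    and \<mu>: "\<And>i. X $ 1 $ i * \<mu> $ i \<le> - 2 * c" "\<mu> $ 1 < \<mu> $ 2" and "c > 0"
    and params: "R \<ge> 0" "S \<ge> 0" "lam > 0" "0 < \<delta>" "\<delta> < 1"
  shows "\<exists>K>0. \<forall>\<^sub>F T in sequentially. (\<integral>\<omega>. regret \<mu> (\<lambda>t. A t \<omega>) T \<partial>M) \<ge> K * real T"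
proof -
  interpret oful_run M R \<mu> A \<eta> X lam \<delta> S by fact
  \<comment> \<open>The second-moment bound of \<open>average_weighted_noise\<close>, with 2 as the
    largest feature.\<close>
  define B where "B = 2\<^sup>2 * (4 * exp (R\<^sup>2 / 2))"
  define q where "q = c\<^sup>2 / (2 * c\<^sup>2 + B)"
  have "B > 0" by (simp add: B_def)
  then have "q > 0" using \<open>c > 0\<close> by (simp add: q_def add_nonneg_pos)
  obtain n where n: "conf_radius R S lam \<delta> (lam + 4 * real t) * sqrt (lam + 4 * real t) < c * real t"
    if "t \<ge> n" for t
    using conf_radius_sublinear[OF \<open>lam > 0\<close> \<open>\<delta> > 0\<close> \<open>c > 0\<close>, of R S]
    by (auto simp: eventually_sequentially)
  have X_le: "\<bar>X $ 1 $ i\<bar> \<le> 2" for i using exhaust_2[of i] X by auto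
  have prob_ge: "q \<le> prob {\<omega> \<in> space M. A (Suc t) \<omega> = 1}" if "t \<ge> n" "t \<ge> 1" for t
    unfolding q_def
  proof (rule prob_ge_of_centered)
    let ?Z = "\<lambda>\<omega>. (\<Sum>s\<in>{1..t}. X $ 1 $ A s \<omega> * \<eta> s \<omega>) / real t"
    note Z = average_weighted_noise[of "\<lambda>i. X $ 1 $ i", OF X_le \<open>t \<ge> 1\<close>]
    show "integrable M ?Z" "integrable M (\<lambda>\<omega>. (?Z \<omega>)\<^sup>2)" "expectation ?Z = 0" by (fact Z)+
    show "expectation (\<lambda>\<omega>. (?Z \<omega>)\<^sup>2) \<le> B" unfolding B_def by (fact Z)
    show "{\<omega> \<in> space M. A (Suc t) \<omega> = 1} \<in> events"
      by (rule arm_event) simp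
    fix \<omega> assume "\<omega> \<in> space M - {\<omega> \<in> space M. A (Suc t) \<omega> = 1}"
    then have "c * real t \<le> (\<Sum>s\<in>{1..t}. X $ 1 $ A s \<omega> * \<eta> s \<omega>)"
      using weighted_noise_large[OF run X \<mu>(1) params n[OF \<open>t \<ge> n\<close>]] by blast
    then show "c \<le> ?Z \<omega>" using \<open>t \<ge> 1\<close> by (simp add: field_simps)
  qed fact+
  define p where "p t = prob {\<omega> \<in> space M. A t \<omega> = 1}" for t
  have "(\<mu> $ 2 - \<mu> $ 1) * q / 2 * real T \<le> (\<integral>\<omega>. regret \<mu> (\<lambda>t. A t \<omega>) T \<partial>M)"
    if T: "T \<ge> 2 * (n + 1)" for T
  proof -
    \<comment> \<open>Rounds up to \<open>n + 1\<close> are discarded, at most half of all rounds.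
      From round \<open>n + 2\<close> on, the preceding round is both at least \<open>n\<close> and
      at least 1, as \<open>prob_ge\<close> requires.\<close>
    have "q * (real T / 2) \<le> q * (real T - real (n + 1))"
      using T \<open>q > 0\<close> by (intro mult_left_mono) auto
    also have "\<dots> = (\<Sum>t\<in>{n+2..T}. q)" using T by (simp add: of_nat_diff algebra_simps)
    also have "\<dots> \<le> (\<Sum>t\<in>{n+2..T}. p t)"
    proof (rule sum_mono)
      fix t assume "t \<in> {n+2..T}"
      then have "n \<le> t - 1" "1 \<le> t - 1" "Suc (t - 1) = t" by auto
      then show "q \<le> p t" using prob_ge[of "t - 1"] by (simp add: p_def)
    qed
    also have "\<dots> \<le> (\<Sum>t\<in>{1..T}. p t)" by (rule sum_mono2) (auto simp: p_def)
    finally have "q * (real T / 2) \<le> (\<Sum>t\<in>{1..T}. p t)" .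
    then have "(\<mu> $ 2 - \<mu> $ 1) * (q * (real T / 2)) \<le> (\<mu> $ 2 - \<mu> $ 1) * (\<Sum>t\<in>{1..T}. p t)"
      using \<mu>(2) by (intro mult_left_mono) auto
    then show ?thesis
      using expected_regret_two_arms[OF bandit_run_axioms, of \<mu> T] \<mu>(2) by (simp add: p_def)
  qed
  moreover have "(\<mu> $ 2 - \<mu> $ 1) * q / 2 > 0" using \<mu>(2) \<open>q > 0\<close> by simp
  ultimately show ?thesis
    by (intro exI[of _ "(\<mu> $ 2 - \<mu> $ 1) * q / 2"]) (auto simp: eventually_sequentially)
qed

text \<open>The instance is fixed before the noise, the parameters of OFUL and its tie-breaking, so
  one instance defeats all these runs; the constant \<open>K\<close> may depend on the run.\<close>

theorem theorem2:
  fixes X :: "real^2^1" and c :: real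
  assumes "X = vector [vector [1, 2]]"
    and "c > 0"
  shows "\<exists>(\<theta> :: real^1) (\<epsilon> :: real^2) (\<mu> :: real^2).
    \<mu> = transpose X *v \<theta> + \<epsilon> \<and>
    \<mu> $ 2 > \<mu> $ 1 \<and> \<mu> $ 2 \<noteq> 2 * \<mu> $ 1 \<and>
    (\<forall>i. \<bar>\<epsilon> $ i\<bar> > c) \<and>
    deviation_property X c 0 \<mu> \<and>
    (\<forall>(M :: 'a measure) A \<eta> R lam \<delta> S.
       R \<ge> 0 \<longrightarrow> lam > 0 \<longrightarrow> 0 < \<delta> \<longrightarrow> \<delta> < 1 \<longrightarrow> norm \<theta> \<le> S \<longrightarrow>
       oful_run M R \<mu> A \<eta> X lam \<delta> S \<longrightarrow>
       (\<exists>K>0. \<forall>\<^sub>F T in sequentially.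
          (\<integral>\<omega>. regret \<mu> (\<lambda>t. A t \<omega>) T \<partial>M) \<ge> K * real T))"
proof -
  have X: "X $ 1 $ 1 = 1" "X $ 1 $ 2 = 2" by (simp_all add: assms(1))
  \<comment> \<open>Both means are negative, so either arm drives the estimate below zero, where the
    linear model ranks arm 1 first although arm 2 is better. The products of feature and mean are
    \<open>- 3 * c\<close> and \<open>- 4 * c\<close>, and \<open>2 * \<mu> $ 1 - \<mu> $ 2\<close>
    is \<open>- 4 * c\<close>.\<close>
  define \<mu> :: "real^2" where "\<mu> = vector [- 3 * c, - 2 * c]"
  have \<mu>: "\<mu> $ 1 = - 3 * c" "\<mu> $ 2 = - 2 * c" by (simp_all add: \<mu>_def)
  have gap: "X $ 1 $ i * \<mu> $ i \<le> - 2 * c" for i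
    using exhaust_2[of i] X \<mu> \<open>c > 0\<close> by auto
  have "\<bar>\<mu> $ i\<bar> > c" for i using exhaust_2[of i] \<mu> \<open>c > 0\<close> by auto
  moreover have "deviation_property X c 0 \<mu>"
    using deviation_property_1_2[OF X \<open>c > 0\<close>] \<mu> \<open>c > 0\<close> by simp
  \<comment> \<open>With the zero parameter the deviation vector is \<open>\<mu>\<close> itself, and
    the norm bound reduces to nonnegativity of \<open>S\<close>.\<close>
  moreover have "\<exists>K>0. \<forall>\<^sub>F T in sequentially. (\<integral>\<omega>. regret \<mu> (\<lambda>t. A t \<omega>) T \<partial>M) \<ge> K * real T"
    if "R \<ge> 0" "lam > 0" "0 < \<delta>" "\<delta> < 1" "norm (0 :: real^1) \<le> S"
      and "oful_run M R \<mu> A \<eta> X lam \<delta> S"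
    for M :: "'a measure" and A \<eta> R lam \<delta> S
    using oful_linear_regret[OF that(6) X gap _ \<open>c > 0\<close>] that \<mu> \<open>c > 0\<close> by simp
  moreover have "\<mu> = transpose X *v 0 + \<mu>" "\<mu> $ 2 > \<mu> $ 1" "\<mu> $ 2 \<noteq> 2 * \<mu> $ 1"
    using \<mu> \<open>c > 0\<close> by simp_all
  ultimately show ?thesis
    by (intro exI[of _ "0 :: real^1"] exI[of _ \<mu>] conjI allI impI)
qed

end
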